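(* The sets of patterns $\{132,2213\}$ and $\{213,1322\}$ are $m$-equivalent, that is, $\{132,2213\}\sim\{213,1322\}$.
   Context: A (finite, reduced) multiset is $S=1^{a_1}2^{a_2}\cdots k^{a_k}$ with $k\ge 1$ and all $a_i\ge 1$, meaning that $i$ occurs with multiplicity $a_i$. A multipermutation of $S$ is a word having exactly $a_i$ occurrences of each letter $i\in[k]=\{1,\dots,k\}$ and no other letters. A word $\pi=\pi_1\cdots\pi_n$ contains a pattern (word) $\rho=\rho_1\cdots\rho_\ell$ if there are indices $i(1)<\cdots<i(\ell)$ such that for all $a,b\in[\ell]$: $\pi_{i(a)}<\pi_{i(b)}$ iff $\rho_a<\rho_b$, and $\pi_{i(a)}>\pi_{i(b)}$ iff $\rho_a>\rho_b$; otherwise $\pi$ avoids $\rho$. For a set $P$ of patterns, $\mathrm{av}(S;P)$ is the number of multipermutations of $S$ that avoid every pattern in $P$. Two sets of patterns $P,Q$ are $m$-equivalent, written here $P\sim Q$, if $\mathrm{av}(S;P)=\mathrm{av}(S;Q)$ for every multiset $S$. *)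

theory Defs
  imports "HOL-Combinatorics.Multiset_Permutations"
begin

text \<open>The multiset $S = 1^{a_1} 2^{a_2} \cdots k^{a_k}$ with $k \ge 1$ and all $a_i \ge 1$ is the
  \<^typ>\<open>nat multiset\<close> \<open>S\<close> with \<open>a\<^sub>i = count S i\<close>; all its letters in \<open>{1..k}\<close> occur,
  and no others.\<close>

definition reduced_multiset :: "nat multiset \<Rightarrow> bool" where
  "reduced_multiset S \<longleftrightarrow> (\<exists>k\<ge>1. set_mset S = {1..k})"

text \<open>Positions in words are counted from 0, as usual for lists.\<close>

definition contains_pattern :: "nat list \<Rightarrow> nat list \<Rightarrow> bool" where
  "contains_pattern \<pi> \<rho> \<longleftrightarrow>
     (\<exists>i :: nat \<Rightarrow> nat.
        strict_mono_on {..<length \<rho>} i \<and>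
        (\<forall>a<length \<rho>. i a < length \<pi>) \<and>
        (\<forall>a<length \<rho>. \<forall>b<length \<rho>.
           (\<pi> ! i a < \<pi> ! i b \<longleftrightarrow> \<rho> ! a < \<rho> ! b) \<and>
           (\<pi> ! i a > \<pi> ! i b \<longleftrightarrow> \<rho> ! a > \<rho> ! b)))"

definition avoids :: "nat list \<Rightarrow> nat list \<Rightarrow> bool" where
  "avoids \<pi> \<rho> \<longleftrightarrow> \<not> contains_pattern \<pi> \<rho>"

definition av :: "nat multiset \<Rightarrow> nat list set \<Rightarrow> nat" where
  "av S P = card {\<pi> \<in> permutations_of_multiset S. \<forall>\<rho>\<in>P. avoids \<pi> \<rho>}"

definition m_equivalent :: "nat list set \<Rightarrow> nat list set \<Rightarrow> bool" where
  "m_equivalent P Q \<longleftrightarrow> (\<forall>S. reduced_multiset S \<longrightarrow> av S P = av S Q)"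

end

theory Submission
  imports Defs "HOL-Library.Sublist"
begin

text \<open>A word avoiding 213 and 1322 is built by inserting the letters in increasing order. All copies
  of a new largest letter \<open>m\<close> must go into \<^emph>\<open>sites\<close> of the word over the smaller letters, the same site
  being allowed repeatedly, and the number of sites of the new word depends only on the number of
  sites of the old word and on the chosen multiset of sites. So the avoiders of \<open>S\<close> are counted by
  \<open>(T\<^sub>a\<^sub>1 \<circ> \<dots> \<circ> T\<^sub>a\<^sub>k) 1\<close> evaluated at \<open>0\<close>, where \<open>T\<^sub>a\<close> is a linear operator on functions of
  \<open>g\<close> = number of sites minus one. These operators do not commute, but each is self-adjoint with
  respect to the kernel \<open>K g h = (g + h) choose g\<close>: applying \<open>T\<^sub>a\<close> to the first or to the second
  argument of \<open>K\<close> gives the same function. Since \<open>K g 0 = K 0 h = 1\<close>, the count is unchanged when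
  \<open>a\<^sub>1, \<dots>, a\<^sub>k\<close> is reversed, and reverse-complementation turns 213 and 1322 into 132 and 2213
  while reversing the multiplicities.\<close>

section \<open>The transfer operators and their adjointness\<close>

lemma binomial_add_symmetric: "((m + n) choose m) = ((m + n) choose n)" for m n :: nat
  using binomial_symmetric[of m "m + n"] by simp

section \<open>Multisets of fixed size over a finite set\<close>

definition multisets_over :: "'a set \<Rightarrow> nat \<Rightarrow> 'a multiset set" where
  "multisets_over X n = {M. set_mset M \<subseteq> X \<and> size M = n}"

lemma finite_multisets_over: "finite X \<Longrightarrow> finite (multisets_over X n)"
proof -
  assume "finite X"
  have "multisets_over X n \<subseteq> mset ` {xs. set xs \<subseteq> X \<and> length xs = n}"
  proof
    fix M assume M: "M \<in> multisets_over X n"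
    obtain xs where "mset xs = M" using ex_mset by blast
    with M show "M \<in> mset ` {xs. set xs \<subseteq> X \<and> length xs = n}"
      by (auto simp: multisets_over_def)
  qed
  then show ?thesis
    by (rule finite_subset) (simp add: finite_lists_length_eq \<open>finite X\<close>)
qed

lemma multisets_over_0 [simp]: "multisets_over X 0 = {{#}}"
  by (auto simp: multisets_over_def)

lemma multisets_over_insert_Suc:
  "multisets_over (insert x X) (Suc n) =
     multisets_over X (Suc n) \<union> add_mset x ` multisets_over (insert x X) n"
proof (intro equalityI subsetI)
  fix M assume M: "M \<in> multisets_over (insert x X) (Suc n)"
  show "M \<in> multisets_over X (Suc n) \<union> add_mset x ` multisets_over (insert x X) n"
  proof (cases "x \<in># M")
    case True
    then obtain N where "M = add_mset x N" by (metis mset_add)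
    with M show ?thesis by (auto simp: multisets_over_def)
  qed (use M in \<open>auto simp: multisets_over_def\<close>)
qed (auto simp: multisets_over_def)

lemma sum_multisets_over_insert_Suc:
  assumes "finite X" "x \<notin> X"
  shows "(\<Sum>M\<in>multisets_over (insert x X) (Suc n). f M) =
     (\<Sum>M\<in>multisets_over X (Suc n). f M) + (\<Sum>M\<in>multisets_over (insert x X) n. f (add_mset x M))"
proof -
  have "multisets_over X (Suc n) \<inter> add_mset x ` multisets_over (insert x X) n = {}"
    using assms(2) by (auto simp: multisets_over_def)
  moreover have "inj_on (add_mset x) S" for S :: "'a multiset set"
    by (auto intro: inj_onI)
  ultimately show ?thesis
    unfolding multisets_over_insert_Suc
    by (subst sum.union_disjoint) (auto simp: finite_multisets_over assms sum.reindex)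
qed

lemma multisets_over_singleton: "multisets_over {x} n = {replicate_mset n x}"
proof (intro equalityI subsetI)
  fix M assume "M \<in> multisets_over {x} n"
  then show "M \<in> {replicate_mset n x}"
    using set_mset_subset_singletonD[of M x] by (auto simp: multisets_over_def)
qed (auto simp: multisets_over_def split: if_splits)

text \<open>Each \<open>H\<close> acts as \<open>H\<close> further copies of the point \<open>x\<close>, so this is stars and bars over
  \<open>card Y + H + 1\<close> points.\<close>

lemma sum_multisets_over_choose:
  assumes "finite Y" "x \<notin> Y"
  shows "(\<Sum>M\<in>multisets_over (insert x Y) n. (count M x + H) choose H) = (n + card Y + H) choose n"
  using assms
proof (induction Y arbitrary: n rule: finite_induct)
  case empty
  then show ?case by (simp add: multisets_over_singleton binomial_add_symmetric)
next
  case (insert y Y)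
  show ?case
  proof (induction n)
    case 0
    then show ?case by simp
  next
    case (Suc n)
    \<comment> \<open>Pascal's rule: split by whether \<open>y\<close> occurs. Since
      \<open>y\<close> differs from \<open>x\<close>, removing one copy of \<open>y\<close> leaves
      \<open>count M x\<close> unchanged.\<close>
    have "(\<Sum>M\<in>multisets_over (insert x (insert y Y)) (Suc n). (count M x + H) choose H) =
      (\<Sum>M\<in>multisets_over (insert x Y) (Suc n). (count M x + H) choose H)
      + (\<Sum>M\<in>multisets_over (insert x (insert y Y)) n. (count M x + H) choose H)"
      using sum_multisets_over_insert_Suc[of "insert x Y" y "\<lambda>M. (count M x + H) choose H" n]
        insert by (auto simp: insert_commute)
    with Suc insert show ?case by (simp add: add_ac)
  qed
qed

text \<open>If \<open>a\<close> copies of a new largest letter go into the multiset \<open>M\<close> of positions of a word with site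
  set \<open>X\<close>, then \<open>site_label X M\<close> is one less than the number of sites of the result
  (see \<open>card_sites\<close>). It is only meaningful for nonempty \<open>M\<close>.\<close>

definition site_label :: "nat set \<Rightarrow> nat multiset \<Rightarrow> nat" where
  "site_label X M =
     (if 0 \<in># M then count M 0
      else if size M = 1 then card {x \<in> X. x \<le> Min (set_mset M)}
      else if count M (Min (set_mset M)) = size M then 2
      else if Suc (count M (Min (set_mset M))) = size M then 1
      else 0)"

text \<open>The sites are renumbered as \<open>{..g}\<close>, which \<open>sum_site_label\<close>
  justifies. In \<open>foldr transfer\<close> over a list, the operator of the last multiplicity
  acts on \<open>\<phi>\<close> first.\<close>

definition transfer :: "nat \<Rightarrow> (nat \<Rightarrow> nat) \<Rightarrow> nat \<Rightarrow> nat" where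
  "transfer a \<phi> g = (\<Sum>M\<in>multisets_over {..g} a. \<phi> (site_label {..g} M))"

text \<open>A single letter at site \<open>x\<close> gives label \<open>x + 1\<close>, also for
  \<open>x = 0\<close>, so this is the hockey-stick sum with its first term missing. That term is
  the \<open>+ 1\<close>, and the right-hand side is visibly symmetric in \<open>g\<close> and
  \<open>h\<close>.\<close>

lemma transfer_choose_1:
  "transfer 1 (\<lambda>g. (g + h) choose g) g + 1 = ((g + h + 2) choose (g + 1))"
proof -
  have m: "multisets_over {..g} 1 = (\<lambda>x. {#x#}) ` {..g}"
    by (auto simp: multisets_over_def image_iff)
      (metis One_nat_def atMost_iff insert_subset
        set_mset_add_mset_insert size_1_singleton_mset)
  have l: "site_label {..g} {#x#} = Suc x" if "x \<le> g" for x
  proof -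
    have "{y. y \<le> g \<and> y \<le> x} = {..x}" using that by auto
    then show ?thesis by (auto simp: site_label_def)
  qed
  have "transfer 1 (\<lambda>g. (g + h) choose g) g = (\<Sum>x\<le>g. (Suc x + h) choose (Suc x))"
    unfolding transfer_def m by (subst sum.reindex) (auto simp: inj_on_def l)
  then have "transfer 1 (\<lambda>g. (g + h) choose g) g + 1 = (\<Sum>x\<le>Suc g. (x + h) choose x)"
    by (subst sum.atMost_Suc_shift) simp
  also have "\<dots> = (g + h + 2) choose (g + 1)"
    using sum_choose_lower[of h "Suc g"] by (simp add: add_ac)
  finally show ?thesis .
qed

text \<open>Giving each \<open>M\<close> the value of the kernel at label \<open>count M 0\<close>
  yields the stars-and-bars term. Only two families avoiding site 0 deviate: all copies at one site
  (label 2, \<open>g\<close> of them), and all but one at the smallest site (label 1,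
  \<open>g\<close> choose 2 of them). Their excesses add up to half of
  \<open>g * h * (g + h + 2)\<close>, hence the doubling. Both terms are symmetric in
  \<open>g\<close> and \<open>h\<close>.\<close>

lemma transfer_choose_ge_2:
  assumes a: "a \<ge> 2"
  shows "2 * transfer a (\<lambda>g. (g + h) choose g) g =
    2 * ((a + g + h) choose a) + g * h * (g + h + 2)"
proof -
  \<comment> \<open>The excess of the kernel at label 2 over its value 1 at label 0. At label 1 the
    excess is \<open>h\<close>.\<close>
  define e where "e = h + (h + 1 choose 2)"
  have c2: "((2 + h) choose 2) = 1 + e"
    by (simp add: e_def numeral_2_eq_2)
  have e: "2 * e = h * (h + 3)"
    unfolding e_def by (induction h) (auto simp: numeral_2_eq_2 algebra_simps)
  \<comment> \<open>\<open>A\<close> and \<open>B\<close> are the families of labels 2 and 1 among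
    the multisets without 0. In \<open>B\<close>, \<open>p\<close> is the smallest site and
    \<open>q\<close> the site of the one stray copy.\<close>
  define A where "A = (\<lambda>x. replicate_mset a x) ` {1..g}"
  define B where "B = (\<lambda>(q, p). add_mset q (replicate_mset (a - 1) p)) ` (SIGMA q:{1..g}. {1..<q})"
  let ?X = "multisets_over {..g} a"
  have fin: "finite ?X" by (simp add: finite_multisets_over)
  have AX: "A \<subseteq> ?X" using a by (auto simp: A_def multisets_over_def split: if_splits)
  have BX: "B \<subseteq> ?X" using a by (auto simp: B_def multisets_over_def split: if_splits)
  have cA: "card A = g"
    unfolding A_def using a by (subst card_image) (auto intro!: inj_onI dest!: arg_cong[where f = set_mset])
  have cB: "2 * card B + g = g * g"
  proof -
    \<comment> \<open>Since \<open>a \<ge> 2\<close>, both \<open>p\<close> and \<open>q\<close>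
      occur, so the support together with \<open>p < q\<close> recovers the pair.\<close>
    have "inj_on (\<lambda>(q, p). add_mset q (replicate_mset (a - 1) p)) (SIGMA q:{1..g}. {1..<q})"
    proof (intro inj_onI, clarsimp)
      fix p q p' q' :: nat
      assume "p < q" "p' < q'"
        and eq: "add_mset q (replicate_mset (a - Suc 0) p) = add_mset q' (replicate_mset (a - Suc 0) p')"
      from arg_cong[OF eq, of set_mset] a have "{q, p} = {q', p'}" by (simp split: if_splits)
      with \<open>p < q\<close> \<open>p' < q'\<close> show "q = q' \<and> p = p'" by (auto simp: doubleton_eq_iff)
    qed
    then have "card B = (\<Sum>q=1..g. q - 1)"
      unfolding B_def by (subst card_image) auto
    moreover have "2 * (\<Sum>q=1..g. q - 1) + g = g * g"
      by (induction g) (auto simp: algebra_simps)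
    ultimately show ?thesis by simp
  qed
  have pt: "(site_label {..g} M + h) choose (site_label {..g} M) =
    ((count M 0 + h) choose h) + (if M \<in> A then e else 0) + (if M \<in> B then h else 0)"
    if M: "M \<in> ?X" for M
  proof -
    have sz: "size M = a" and sub: "set_mset M \<subseteq> {..g}" using M by (auto simp: multisets_over_def)
    have ne: "M \<noteq> {#}" using sz a by auto
    show ?thesis
    proof (cases "0 \<in># M")
      case True
      then have "M \<notin> A" "M \<notin> B" by (auto simp: A_def B_def split: if_splits)
      then show ?thesis using True by (simp add: site_label_def binomial_add_symmetric)
    next
      case False
      define p where "p = Min (set_mset M)"
      have p: "p \<in># M" unfolding p_def using ne by (intro Min_in) auto
      have ple: "p \<le> q" if "q \<in># M" for q unfolding p_def using that by auto
      have pg: "p \<in> {1..g}" using p False sub by (cases "p = 0") auto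
      have MA: "M \<in> A \<longleftrightarrow> count M p = size M"
      proof
        assume "M \<in> A"
        then obtain x where "M = replicate_mset a x" by (auto simp: A_def)
        with p show "count M p = size M" by (auto split: if_splits)
      next
        assume *: "count M p = size M"
        have "replicate_mset (count M p) p \<subseteq># M" by (simp add: mset_subset_eqI)
        with * have "M = replicate_mset a p"
          by (metis mset_subset_size size_replicate_mset subset_mset.le_imp_less_or_eq sz less_irrefl)
        with pg show "M \<in> A" by (auto simp: A_def)
      qed
      have MB: "M \<in> B \<longleftrightarrow> Suc (count M p) = size M"
      proof
        assume "M \<in> B"
        then obtain r q where rq: "M = add_mset q (replicate_mset (a - 1) r)" "r < q"
          by (auto simp: B_def)
        then have "p = r" using a unfolding p_def by (intro Min_eqI) (auto split: if_splits)
        with rq a show "Suc (count M p) = size M" by auto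
      next
        assume *: "Suc (count M p) = size M"
        have "replicate_mset (count M p) p \<subseteq># M" by (simp add: mset_subset_eqI)
        then obtain N where N: "M = replicate_mset (a - 1) p + N"
          using * sz by (metis diff_Suc_1 subset_mset.le_iff_add)
        with sz a have "size N = 1" by simp
        then obtain q where q: "N = {#q#}" using size_1_singleton_mset by blast
        with N have q': "M = add_mset q (replicate_mset (a - 1) p)" by simp
        then have "q \<noteq> p" using * a sz by auto
        moreover have "q \<in># M" using q' by simp
        ultimately have "p < q" "q \<le> g" using ple[of q] sub by auto
        with q' pg show "M \<in> B" unfolding B_def by (intro image_eqI[where x = "(q, p)"]) auto
      qed
      have "count M 0 = 0" using False by (simp add: not_in_iff)
      then show ?thesis using False sz a MA MB c2
        by (auto simp: site_label_def p_def[symmetric])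
    qed
  qed
  have "{..g} = insert 0 {1..g}" by auto
  then have s: "(\<Sum>M\<in>?X. (count M 0 + h) choose h) = (a + g + h) choose a"
    using sum_multisets_over_choose[of "{1..g}" 0 h a] by simp
  have "transfer a (\<lambda>g. (g + h) choose g) g =
    (\<Sum>M\<in>?X. ((count M 0 + h) choose h) + (if M \<in> A then e else 0) + (if M \<in> B then h else 0))"
    unfolding transfer_def by (intro sum.cong refl pt)
  also have "\<dots> = ((a + g + h) choose a) + card A * e + card B * h"
    using AX BX fin by (simp add: sum.distrib s sum.inter_restrict[symmetric] Int_absorb1)
  \<comment> \<open>The summand \<open>g * h\<close> is added so that \<open>2 * card B + g\<close>
    can be replaced by \<open>g * g\<close> without subtraction.\<close>
  finally have "2 * transfer a (\<lambda>g. (g + h) choose g) g + g * h =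
     2 * ((a + g + h) choose a) + g * (2 * e) + (2 * card B + g) * h"
    by (simp add: cA algebra_simps)
  then show ?thesis unfolding e cB by (simp add: algebra_simps)
qed

lemma transfer_choose_symmetric:
  assumes "a \<ge> 1"
  shows "transfer a (\<lambda>g. (g + h) choose g) g = transfer a (\<lambda>h. (g + h) choose g) h"
proof -
  \<comment> \<open>This rewrites the kernel so that the closed forms apply with \<open>g\<close>
    and \<open>h\<close> exchanged.\<close>
  have sw: "(\<lambda>h. (g + h) choose g) = (\<lambda>h. (h + g) choose h)"
    using binomial_add_symmetric[of g] by (simp add: fun_eq_iff add.commute)
  show ?thesis
  proof (cases "a = 1")
    case True
    have "(g + h + 2) choose (g + 1) = (h + g + 2) choose (h + 1)"
      using binomial_add_symmetric[of "g + 1" "h + 1"] by (simp add: add_ac)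
    with transfer_choose_1[of h g] transfer_choose_1[of g h] True show ?thesis
      by (simp add: sw)
  next
    case False
    with assms have "a \<ge> 2" by simp
    then have "2 * transfer a (\<lambda>g. (g + h) choose g) g = 2 * transfer a (\<lambda>h. (h + g) choose h) h"
      unfolding transfer_choose_ge_2[OF \<open>a \<ge> 2\<close>] by (simp add: add_ac mult_ac)
    then show ?thesis unfolding sw by simp
  qed
qed

lemma transfer_sum:
  "transfer a (\<lambda>h. \<Sum>i\<in>I. f i h) g = (\<Sum>i\<in>I. transfer a (f i) g)"
  unfolding transfer_def by (rule sum.swap)

text \<open>Linearity lets an operator acting on \<open>g\<close>, being a finite sum, pass through
  a composition of operators acting on \<open>h\<close>.\<close>

lemma foldr_transfer_sum:
  "foldr transfer as (\<lambda>h. \<Sum>i\<in>I. f i h) = (\<lambda>h. \<Sum>i\<in>I. foldr transfer as (f i) h)"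
  by (induction as) (simp_all add: fun_eq_iff[of "transfer _ _"] transfer_sum)

text \<open>The operators move one at a time from the first kernel argument to the second. The
  outermost one on the \<open>g\<close> side becomes the innermost one on the \<open>h\<close> side,
  which reverses the list.\<close>

lemma foldr_transfer_choose_rev:
  assumes "\<And>a. a \<in> set as \<Longrightarrow> a \<ge> 1"
  shows "foldr transfer as (\<lambda>g. (g + h) choose g) g =
    foldr transfer (rev as) (\<lambda>h. (g + h) choose g) h"
  using assms
proof (induction as arbitrary: g h)
  case (Cons a as)
  have "foldr transfer (a # as) (\<lambda>g. (g + h) choose g) g =
      transfer a (\<lambda>g. foldr transfer (rev as) (\<lambda>h. (g + h) choose g) h) g"
    unfolding foldr_Cons comp_def
    by (rule arg_cong[where f = "\<lambda>\<phi>. transfer a \<phi> g"]) (use Cons in \<open>simp add: fun_eq_iff\<close>)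
  also have "\<dots> = foldr transfer (rev as) (\<lambda>h. transfer a (\<lambda>g. (g + h) choose g) g) h"
    unfolding transfer_def[of a] foldr_transfer_sum ..
  \<comment> \<open>Self-adjointness for the single operator, which now stands last in
    \<open>rev (a # as)\<close>.\<close>
  also have "\<dots> = foldr transfer (rev as) (transfer a (\<lambda>h. (g + h) choose g)) h"
    using transfer_choose_symmetric Cons.prems by simp
  finally show ?case by simp
qed simp

lemma foldr_transfer_rev:
  assumes "\<And>a. a \<in> set as \<Longrightarrow> a \<ge> 1"
  shows "foldr transfer as (\<lambda>_. 1) 0 = foldr transfer (rev as) (\<lambda>_. 1) 0"
  using foldr_transfer_choose_rev[OF assms, where g = 0 and h = 0] by simp

text \<open>The label depends only on the relative order of the sites and on which of them is 0, so
  the order isomorphism from \<open>X\<close> onto an initial segment preserves it.\<close>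

lemma sum_site_label:
  assumes fin: "finite X" and 0: "0 \<in> X" and a: "a \<ge> 1"
  shows "(\<Sum>M\<in>multisets_over X a. \<phi> (site_label X M)) = transfer a \<phi> (card X - 1)"
proof -
  \<comment> \<open>The rank in \<open>X\<close>. It fixes 0, the site that
    \<open>site_label\<close> singles out.\<close>
  define f where "f x = card {y \<in> X. y < x}" for x
  have mono: "mono f"
    unfolding f_def by (intro monoI card_mono) (use fin in auto)
  have strict: "f x < f y" if "x \<in> X" "x < y" for x y
    unfolding f_def using fin that by (intro psubset_card_mono) auto
  have inj: "inj_on f X"
    by (intro linorder_inj_onI) (use strict in force)+
  have pos: "card X > 0" using fin 0 by (auto simp: card_gt_0_iff)
  have "f ` X \<subseteq> {..<card X}"
    unfolding f_def using fin by (auto intro!: psubset_card_mono)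
  then have img: "f ` X = {..card X - 1}"
    using pos fin inj by (subst card_subset_eq[of "{..<card X}" "f ` X"]) (auto simp: card_image)
  have f0: "f 0 = 0" by (simp add: f_def)
  have label: "site_label (f ` X) (image_mset f M) = site_label X M"
    if M: "M \<in> multisets_over X a" for M
  proof -
    have sub: "set_mset M \<subseteq> X" and ne: "M \<noteq> {#}" using M a by (auto simp: multisets_over_def)
    define p where "p = Min (set_mset M)"
    have p: "p \<in># M" unfolding p_def using ne by (intro Min_in) auto
    \<comment> \<open>Multiplicities survive because the rank is injective on \<open>X\<close>;
      outside \<open>X\<close> it need not be.\<close>
    have count: "count (image_mset f M) (f x) = count M x" if "x \<in> X" for x
    proof -
      have "f -` {f x} \<inter> set_mset M = (if x \<in># M then {x} else {})"
        using inj sub that by (auto dest: inj_onD)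
      then show ?thesis by (simp add: count_image_mset not_in_iff)
    qed
    have Min: "Min (set_mset (image_mset f M)) = f p"
      unfolding p_def using ne mono by (simp add: mono_Min_commute)
    have mem0: "0 \<in># image_mset f M \<longleftrightarrow> 0 \<in># M"
      using count[OF 0] by (metis f0 not_in_iff)
    have "{y \<in> f ` X. y \<le> f p} = f ` {x \<in> X. x \<le> p}"
      using strict p sub mono by (auto simp: not_less[symmetric] dest: monoD)
    then have card: "card {y \<in> f ` X. y \<le> f p} = card {x \<in> X. x \<le> p}"
      using inj by (simp add: card_image inj_on_def)
    show ?thesis
      using count[OF 0] count[of p] p sub
      unfolding site_label_def Min p_def[symmetric] mem0 card f0 by auto
  qed
  have "bij_betw (image_mset f) (multisets_over X a) (multisets_over (f ` X) a)"
  proof (intro bij_betw_imageI equalityI subsetI)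
    show "inj_on (image_mset f) (multisets_over X a)"
    proof (rule inj_onI)
      fix M N assume *: "M \<in> multisets_over X a" "N \<in> multisets_over X a" "image_mset f M = image_mset f N"
      have "image_mset (inv_into X f) (image_mset f K) = K" if "K \<in> multisets_over X a" for K
      proof -
        have "image_mset (inv_into X f \<circ> f) K = image_mset id K"
          using that inj by (intro image_mset_cong) (auto simp: multisets_over_def)
        then show ?thesis by (simp add: image_mset.compositionality)
      qed
      with * show "M = N" by metis
    qed
  next
    fix N assume N: "N \<in> multisets_over (f ` X) a"
    have "image_mset (f \<circ> inv_into X f) N = image_mset id N"
      using N by (intro image_mset_cong) (auto simp: multisets_over_def f_inv_into_f subset_iff)
    then have "N = image_mset f (image_mset (inv_into X f) N)"
      by (simp add: image_mset.compositionality)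
    moreover have "image_mset (inv_into X f) N \<in> multisets_over X a"
      using N by (auto simp: multisets_over_def intro!: inv_into_into)
    ultimately show "N \<in> image_mset f ` multisets_over X a" by blast
  qed (auto simp: multisets_over_def; blast)
  then have "(\<Sum>N\<in>multisets_over (f ` X) a. \<phi> (site_label (f ` X) N)) =
    (\<Sum>M\<in>multisets_over X a. \<phi> (site_label (f ` X) (image_mset f M)))"
    by (rule sum.reindex_bij_betw[symmetric])
  also have "\<dots> = (\<Sum>M\<in>multisets_over X a. \<phi> (site_label X M))"
    by (intro sum.cong refl) (simp add: label)
  finally show ?thesis by (simp add: transfer_def img)
qed

section \<open>Words with a distinguished letter, encoded by gap multisets\<close>

text \<open>Each \<open>m\<close> in the word is recorded by the number of letters other than \<open>m\<close> before it.\<close>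

fun gaps :: "'a \<Rightarrow> 'a list \<Rightarrow> nat multiset" where
  "gaps m [] = {#}"
| "gaps m (x # w) = (if x = m then add_mset 0 (gaps m w) else image_mset Suc (gaps m w))"

lemma size_gaps: "size (gaps m w) = count (mset w) m"
  by (induction w) auto

lemma gaps_append:
  "gaps m (u @ v) = gaps m u + image_mset ((+) (length (filter (\<lambda>x. x \<noteq> m) u))) (gaps m v)"
  by (induction u) (auto simp: image_mset.compositionality comp_def)

lemma in_gaps_iff:
  "p \<in># gaps m w \<longleftrightarrow> (\<exists>u v. w = u @ m # v \<and> length (filter (\<lambda>x. x \<noteq> m) u) = p)"
proof (intro iffI)
  assume "p \<in># gaps m w"
  then show "\<exists>u v. w = u @ m # v \<and> length (filter (\<lambda>x. x \<noteq> m) u) = p"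
  proof (induction w arbitrary: p)
    case (Cons x w)
    show ?case
    proof (cases "x = m \<and> p = 0")
      case True
      then show ?thesis by (intro exI[of _ "[]"] exI[of _ w]) simp
    next
      case False
      then obtain q where q: "q \<in># gaps m w" "p = (if x = m then q else Suc q)"
        using Cons.prems by (auto split: if_splits)
      with Cons.IH[of q] obtain u v where "w = u @ m # v" "length (filter (\<lambda>x. x \<noteq> m) u) = q"
        by blast
      with q show ?thesis by (intro exI[of _ "x # u"] exI[of _ v]) auto
    qed
  qed simp
qed (auto simp: gaps_append)

text \<open>The word can be read off from left to right: it starts with \<open>m\<close> exactly if
  0 is among the gaps, and otherwise its first letter is that of \<open>s\<close>.\<close>

lemma inj_on_gaps: "inj_on (gaps m) {w. filter (\<lambda>x. x \<noteq> m) w = s}"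
proof (rule inj_onI, clarsimp)
  fix w w' assume "gaps m w = gaps m w'" "filter (\<lambda>x. x \<noteq> m) w' = filter (\<lambda>x. x \<noteq> m) w"
  then show "w = w'"
  proof (induction w arbitrary: w')
    case Nil
    then show ?case by (cases w') (auto split: if_splits)
  next
    case (Cons x w)
    then obtain y v where w': "w' = y # v" by (cases w') (auto split: if_splits)
    have "x = m \<longleftrightarrow> y = m"
      using arg_cong[OF Cons.prems(1), of "\<lambda>M. 0 \<in># M"] w' by (auto split: if_splits)
    moreover have "image_mset Suc A = image_mset Suc B \<longleftrightarrow> A = B" for A B
      using multiset.inj_map[OF inj_Suc] by (rule inj_eq)
    ultimately have "x = y \<and> gaps m w = gaps m v \<and> filter (\<lambda>x. x \<noteq> m) v = filter (\<lambda>x. x \<noteq> m) w"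
      using Cons.prems w' by (cases "x = m") simp_all
    with Cons.IH w' show ?case by simp
  qed
qed

text \<open>Put \<open>count M 0\<close> copies of \<open>m\<close> in front of the first letter of
  \<open>s\<close>, and recurse on the remaining gaps, lowered by one.\<close>

lemma gaps_surj:
  assumes "m \<notin> set s" "set_mset M \<subseteq> {..length s}"
  shows "\<exists>w. filter (\<lambda>x. x \<noteq> m) w = s \<and> gaps m w = M"
  using assms
proof (induction s arbitrary: M)
  case Nil
  then obtain n where "M = replicate_mset n 0"
    using set_mset_subset_singletonD[of M 0] by auto
  moreover have "gaps m (replicate n m) = replicate_mset n 0"
    by (induction n) auto
  ultimately show ?case by (intro exI[of _ "replicate n m"]) auto
next
  case (Cons x s)
  define N where "N = image_mset (\<lambda>i. i - 1) (filter_mset (\<lambda>i. i \<noteq> 0) M)"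
  have "set_mset N \<subseteq> {..length s}" using Cons.prems by (auto simp: N_def)
  with Cons.IH[of N] Cons.prems(1) obtain w where w: "filter (\<lambda>x. x \<noteq> m) w = s" "gaps m w = N"
    by auto
  have "gaps m (replicate n m @ v) = replicate_mset n 0 + gaps m v" for n v
    by (induction n) auto
  moreover have "image_mset Suc N = filter_mset (\<lambda>i. i \<noteq> 0) M"
  proof -
    have "image_mset (\<lambda>i. Suc (i - 1)) (filter_mset (\<lambda>i. i \<noteq> 0) M) = image_mset id (filter_mset (\<lambda>i. i \<noteq> 0) M)"
      by (intro image_mset_cong) auto
    then show ?thesis by (simp add: N_def image_mset.compositionality comp_def)
  qed
  moreover have "replicate_mset (count M 0) 0 + filter_mset (\<lambda>i. i \<noteq> 0) M = M"
    by (auto simp: multiset_eq_iff)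
  ultimately have "filter (\<lambda>y. y \<noteq> m) (replicate (count M 0) m @ x # w) = x # s \<and>
      gaps m (replicate (count M 0) m @ x # w) = M"
    using w Cons.prems(1) by auto
  then show ?case by blast
qed

lemma bij_betw_gaps:
  assumes "m \<notin> set s" "X \<subseteq> {..length s}"
  shows "bij_betw (gaps m) {w. filter (\<lambda>x. x \<noteq> m) w = s \<and> gaps m w \<in> multisets_over X a}
    (multisets_over X a)"
proof (intro bij_betw_imageI equalityI subsetI)
  show "inj_on (gaps m) {w. filter (\<lambda>x. x \<noteq> m) w = s \<and> gaps m w \<in> multisets_over X a}"
    by (rule inj_on_subset[OF inj_on_gaps[of m s]]) auto
next
  fix M assume M: "M \<in> multisets_over X a"
  with assms have "set_mset M \<subseteq> {..length s}" by (auto simp: multisets_over_def)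
  from gaps_surj[OF assms(1) this] M
  show "M \<in> gaps m ` {w. filter (\<lambda>x. x \<noteq> m) w = s \<and> gaps m w \<in> multisets_over X a}"
    by blast
qed auto

section \<open>Sites of an avoider\<close>

text \<open>Phrased with \<open>subseq\<close> on actual letters rather than index maps;
  \<open>contains_213\<close> and \<open>contains_1322\<close> give the link to
  \<open>contains_pattern\<close>.\<close>

definition avoids_213_1322 :: "nat list \<Rightarrow> bool" where
  "avoids_213_1322 w \<longleftrightarrow>
     (\<forall>a b c. a < b \<and> b < c \<longrightarrow> \<not> subseq [b, a, c] w \<and> \<not> subseq [a, c, b, b] w)"

text \<open>The gap after the first \<open>i\<close> letters takes a new largest letter \<open>m\<close> iff the prefix has no
  descent (else 213) and no letter exceeding \<open>hd w\<close>, the minimum of the sorted prefix, occurs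
  twice afterwards (else 1322).\<close>

definition sites :: "nat list \<Rightarrow> nat set" where
  "sites w = {i. i \<le> length w \<and> sorted (take i w) \<and>
     (i = 0 \<or> (\<forall>b>hd w. count_list (drop i w) b \<le> 1))}"

lemma finite_sites: "finite (sites w)"
  by (rule finite_subset[of _ "{..length w}"]) (auto simp: sites_def)

lemma zero_in_sites: "0 \<in> sites w"
  by (simp add: sites_def)

lemma subseq_imp_subset: "subseq xs ys \<Longrightarrow> set xs \<subseteq> set ys"
  by (induction rule: list_emb.induct) auto

lemma sorted_iff_subseq: "sorted xs \<longleftrightarrow> (\<forall>a b. subseq [b, a] xs \<longrightarrow> b \<le> a)"
proof (induction xs)
  case (Cons x xs)
  have "subseq [b, a] (x # xs) \<longleftrightarrow> b = x \<and> a \<in> set xs \<or> subseq [b, a] xs" for a b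
    by (metis subseq_Cons2_iff subseq_singleton_left subseq_Cons')
  then show ?case using Cons.IH by auto
qed simp

lemma subseq_pair_iff_count: "subseq [b, b] xs \<longleftrightarrow> count_list xs b \<ge> 2"
proof (induction xs)
  case (Cons x xs)
  have "b \<in> set xs \<longleftrightarrow> count_list xs b \<ge> 1"
    using count_list_0_iff[of xs b] by linarith
  with Cons show ?case by (auto simp: subseq_singleton_left)
qed simp

text \<open>An occurrence of \<open>m\<close> cuts \<open>s\<close> exactly at the number that
  \<open>gaps\<close> records for it.\<close>

lemma filter_split:
  assumes "filter P w = s" "w = u @ m # v" "\<not> P m"
  shows "filter P u = take (length (filter P u)) s" "filter P v = drop (length (filter P u)) s"
  using assms by auto

text \<open>As \<open>m\<close> is the largest letter, it can only play the role of 3 in either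
  pattern. A new 213 is a descent before some \<open>m\<close>; a new 1322 is a letter before some
  \<open>m\<close> and a larger one, below \<open>m\<close>, occurring twice after it. These are the
  two conditions in \<open>sites\<close>.\<close>

lemma avoids_213_1322_iff_gaps:
  assumes w: "filter (\<lambda>x. x \<noteq> m) w = s" and less: "\<forall>x\<in>set s. x < m"
  shows "avoids_213_1322 w \<longleftrightarrow> avoids_213_1322 s \<and> set_mset (gaps m w) \<subseteq> sites s"
proof
  assume Q: "avoids_213_1322 w"
  have "subseq s w" using w by auto
  then have "avoids_213_1322 s"
    using Q unfolding avoids_213_1322_def by (meson subseq_order.trans)
  moreover have "p \<in> sites s" if "p \<in># gaps m w" for p
  proof -
    obtain u v where uv: "w = u @ m # v" and p: "length (filter (\<lambda>x. x \<noteq> m) u) = p"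
      using \<open>p \<in># gaps m w\<close> by (auto simp: in_gaps_iff)
    note split = filter_split[OF w uv, unfolded p, simplified]
    have "sorted (take p s)" unfolding sorted_iff_subseq
    proof (intro allI impI)
      fix a b assume sub: "subseq [b, a] (take p s)"
      then have "subseq [b, a] u"
        using split(1) by (metis subseq_filter_left subseq_order.trans)
      then have "subseq ([b, a] @ [m]) (u @ (m # v))"
        using list_emb_append_mono[of "(=)" "[b, a]" u "[m]" "m # v"] by simp
      moreover have "b \<in> set (take p s)" using subseq_imp_subset[OF sub] by simp
      then have "b < m" using less by (auto dest: in_set_takeD)
      ultimately show "b \<le> a" using Q uv unfolding avoids_213_1322_def by (auto simp: not_less[symmetric])
    qed
    moreover have "count_list (drop p s) b \<le> 1" if "p \<noteq> 0" "b > hd s" for b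
    proof (rule ccontr)
      assume "\<not> count_list (drop p s) b \<le> 1"
      then have sub: "subseq [b, b] (drop p s)" by (simp add: subseq_pair_iff_count)
      then have "subseq [b, b] v"
        using split(2) by (metis subseq_filter_left subseq_order.trans)
      moreover have "b < m" using subseq_imp_subset[OF sub] less by (auto dest: in_set_dropD)
      \<comment> \<open>As \<open>p\<close> is nonzero, \<open>hd s\<close> lies before this
        \<open>m\<close> and serves as the 1 of a 1322.\<close>
      moreover have "hd s \<in> set (take p s)"
        using \<open>p \<noteq> 0\<close> sub by (cases s; cases p) auto
      then have "hd s \<in> set u" using split(1) by (metis filter_is_subset subsetD)
      then have "subseq [hd s] u" by (simp add: subseq_singleton_left)
      ultimately have "subseq ([hd s] @ [m, b, b]) (u @ (m # v))"
        using list_emb_append_mono[of "(=)" "[hd s]" u "[m, b, b]" "m # v"] by simp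
      with Q uv \<open>b < m\<close> \<open>b > hd s\<close> show False unfolding avoids_213_1322_def by auto
    qed
    moreover have "p \<le> length s" using p uv w by auto
    ultimately show ?thesis by (auto simp: sites_def)
  qed
  ultimately show "avoids_213_1322 s \<and> set_mset (gaps m w) \<subseteq> sites s" by blast
next
  assume "avoids_213_1322 s \<and> set_mset (gaps m w) \<subseteq> sites s"
  then have Q: "avoids_213_1322 s" and M: "\<And>p. p \<in># gaps m w \<Longrightarrow> p \<in> sites s" by auto
  have le: "x \<le> m" if "x \<in> set w" for x using that w less by (cases "x = m") (auto intro: less_imp_le)
  have sub_s: "subseq v s" if "subseq v w" "m \<notin> set v" for v
  proof -
    have "filter (\<lambda>x. x \<noteq> m) v = v" using that(2) by (auto simp: filter_id_conv)
    then show ?thesis using subseq_filter[OF that(1), of "\<lambda>x. x \<noteq> m"] w by simp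
  qed
  show "avoids_213_1322 w" unfolding avoids_213_1322_def
  proof (intro allI impI conjI notI)
    fix a b c :: nat assume abc: "a < b \<and> b < c" and sub: "subseq [b, a, c] w"
    then have "c \<le> m" using subseq_imp_subset[OF sub] by (intro le) auto
    show False
    proof (cases "c = m")
      case True
      from sub have "subseq ([b, a] @ [m]) w" using True by simp
      then obtain u v where uv: "w = u @ v" "subseq [b, a] u" "subseq [m] v"
        using list_emb_appendD by blast
      then obtain v1 v2 where "v = v1 @ m # v2" by (metis in_set_conv_decomp subseq_singleton_left)
      with uv have w': "w = (u @ v1) @ m # v2" and "subseq [b, a] (u @ v1)" by auto
      define p where "p = length (filter (\<lambda>x. x \<noteq> m) (u @ v1))"
      have "p \<in># gaps m w" unfolding in_gaps_iff p_def using w' by blast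
      then have "sorted (take p s)" using M by (simp add: sites_def)
      moreover have split: "filter (\<lambda>x. x \<noteq> m) (u @ v1) = take p s"
        unfolding p_def by (rule filter_split(1)[OF w w']) simp
      have "subseq [b, a] (take p s)"
        using subseq_filter[OF \<open>subseq [b, a] (u @ v1)\<close>, of "\<lambda>x. x \<noteq> m"] abc True
        unfolding split by simp
      ultimately show False using abc unfolding sorted_iff_subseq by (meson not_less)
    next
      case False
      with \<open>c \<le> m\<close> abc have "subseq [b, a, c] s" by (intro sub_s sub) auto
      with Q abc show False by (auto simp: avoids_213_1322_def)
    qed
  next
    fix a b c :: nat assume abc: "a < b \<and> b < c" and sub: "subseq [a, c, b, b] w"
    then have "c \<le> m" using subseq_imp_subset[OF sub] by (intro le) auto
    show False
    proof (cases "c = m")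
      case True
      from sub obtain u v' where uv: "w = u @ v'" "subseq [a] u" "subseq [m, b, b] v'"
        using list_emb_appendD[of "(=)" "[a]" "[m, b, b]" w] True by auto
      from list_emb_ConsD[OF uv(3)] obtain v1 v2 where v': "v' = v1 @ m # v2" "subseq [b, b] v2"
        by blast
      with uv have w': "w = (u @ v1) @ m # v2" by simp
      define p where "p = length (filter (\<lambda>x. x \<noteq> m) (u @ v1))"
      note split = filter_split[OF w w', folded p_def, simplified]
      have "p \<in># gaps m w" unfolding in_gaps_iff p_def using w' by blast
      then have p: "p \<in> sites s" using M by simp
      have "a \<in> set (take p s)"
        using uv(2) abc True split(1)[symmetric] by (auto simp: subseq_singleton_left)
      \<comment> \<open>The prefix is sorted, so \<open>hd s\<close> is at most \<open>a\<close>,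
        and the repeated \<open>b\<close> is subject to the condition in
        \<open>sites\<close>.\<close>
      then have "p \<noteq> 0" and "hd s \<le> a"
        using p by (cases s; cases p; auto simp: sites_def)+
      have "subseq [b, b] (drop p s)"
        using subseq_filter[OF v'(2), of "\<lambda>x. x \<noteq> m"] abc True split(2) by simp
      then have "count_list (drop p s) b \<ge> 2" by (simp add: subseq_pair_iff_count)
      moreover have "count_list (drop p s) b \<le> 1"
        using p \<open>p \<noteq> 0\<close> \<open>hd s \<le> a\<close> abc by (auto simp: sites_def)
      ultimately show False by simp
    next
      case False
      with \<open>c \<le> m\<close> abc have "subseq [a, c, b, b] s" by (intro sub_s sub) auto
      with Q abc show False by (auto simp: avoids_213_1322_def)
    qed
  qed
qed

text \<open>The leftmost run of \<open>m\<close>: its position is the smallest gap and its length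
  \<open>c\<close> the multiplicity of that gap, the data on which \<open>site_label\<close>
  depends.\<close>

lemma first_block:
  assumes "m \<in> set w"
  obtains u c v where "w = u @ replicate c m @ v" "c \<ge> 1" "m \<notin> set u" "v = [] \<or> hd v \<noteq> m"
proof
  let ?r = "dropWhile (\<lambda>x. x \<noteq> m) w"
  have "?r \<noteq> []" "hd ?r = m"
    using assms hd_dropWhile[of "\<lambda>x. x \<noteq> m" w] by auto
  then show "length (takeWhile (\<lambda>x. x = m) ?r) \<ge> 1" by (cases ?r) auto
  have "takeWhile (\<lambda>x. x = m) ?r = replicate (length (takeWhile (\<lambda>x. x = m) ?r)) m"
    by (rule replicate_length_same[symmetric]) (auto dest: set_takeWhileD)
  then show "w = takeWhile (\<lambda>x. x \<noteq> m) w @ replicate (length (takeWhile (\<lambda>x. x = m) ?r)) m @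
      dropWhile (\<lambda>x. x = m) ?r"
    by (metis takeWhile_dropWhile_id)
  show "m \<notin> set (takeWhile (\<lambda>x. x \<noteq> m) w)" by (auto dest: set_takeWhileD)
  show "dropWhile (\<lambda>x. x = m) ?r = [] \<or> hd (dropWhile (\<lambda>x. x = m) ?r) \<noteq> m"
    using hd_dropWhile[of "\<lambda>x. x = m" ?r] by auto
qed

text \<open>Sites of \<open>w\<close> lie at or before the end \<open>p + c\<close> of the first run
  of \<open>m\<close>, since the next letter is a descent. If \<open>p = 0\<close>, the word starts
  with its maximum and nothing else is required. If \<open>p > 0\<close>, \<open>m\<close> exceeds
  \<open>hd w\<close>, so a nonzero site may have at most one \<open>m\<close> to its right.\<close>

lemma card_sites:
  assumes w: "filter (\<lambda>x. x \<noteq> m) w = s" and less: "\<forall>x\<in>set s. x < m"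
    and sub: "set_mset (gaps m w) \<subseteq> sites s" and m: "m \<in> set w"
  shows "card (sites w) - 1 = site_label (sites s) (gaps m w)"
proof -
  obtain u c v where w': "w = u @ replicate c m @ v" and c: "c \<ge> 1" and u: "m \<notin> set u"
    and v: "v = [] \<or> hd v \<noteq> m"
    using first_block[OF m] .
  define p where "p = length u"
  define v' where "v' = filter (\<lambda>x. x \<noteq> m) v"
  define a where "a = count_list w m"
  have fu: "filter (\<lambda>x. x \<noteq> m) u = u" using u by (auto simp: filter_id_conv)
  have s: "s = u @ v'" using w w' fu by (auto simp: v'_def)
  have count_u: "count_list u m = 0" using u by (simp add: count_list_0_iff)
  have rep: "count_list (replicate n x) y = (if x = y then n else 0)" for n and x y :: nat
    by (induction n) auto
  have a: "a = c + count_list v m" by (simp add: a_def w' count_u rep)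
  have "gaps m (replicate n m) = replicate_mset n 0" for n by (induction n) auto
  moreover have "size (gaps m u) = 0" unfolding size_gaps using u by (simp add: count_eq_zero_iff)
  then have "gaps m u = {#}" by simp
  ultimately have g: "gaps m w = replicate_mset c p + image_mset ((+) p) (gaps m v)"
    using fu by (simp add: w' gaps_append p_def image_mset.compositionality comp_def)
  \<comment> \<open>All copies of \<open>m\<close> beyond the first run lie in gaps strictly larger
    than \<open>p\<close>.\<close>
  have g0: "0 \<notin># gaps m v" using v by (cases v) auto
  have "Min (set_mset (gaps m w)) = p"
    using g c by (intro Min_eqI) auto
  moreover have "count (gaps m w) p = c"
  proof -
    have "p \<notin># image_mset ((+) p) (gaps m v)" using g0 by auto
    then have "count (image_mset ((+) p) (gaps m v)) p = 0" by (simp only: not_in_iff)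
    then show ?thesis by (simp add: g)
  qed
  moreover have "0 \<in># gaps m w \<longleftrightarrow> p = 0" using g g0 c by auto
  moreover have "size (gaps m w) = a" by (simp add: size_gaps a_def count_mset)
  ultimately have label: "site_label (sites s) (gaps m w) =
      (if p = 0 then c else if a = 1 then card {x \<in> sites s. x \<le> p}
       else if c = a then 2 else if Suc c = a then 1 else 0)"
    by (auto simp: site_label_def)
  have ps: "p \<in> sites s" using sub g c by auto
  have v_le: "x < m" if "x \<in> set v" "x \<noteq> m" for x
    using less that by (auto simp: s v'_def)
  have su: "sorted u" using ps by (simp add: sites_def s p_def)
  have u_le: "x < m" if "x \<in> set u" for x using less that by (auto simp: s)
  have sorted_take: "sorted (take i w) \<longleftrightarrow> i \<le> p + c" if "i \<le> length w" for i
  proof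
    assume "i \<le> p + c"
    then have "take i w = take i u @ replicate (i - p) m"
      by (simp add: w' p_def)
    then show "sorted (take i w)"
      using su u_le by (auto simp: sorted_append sorted_wrt_take dest!: in_set_takeD intro: less_imp_le)
  next
    assume so: "sorted (take i w)"
    show "i \<le> p + c"
    proof (rule ccontr)
      assume "\<not> i \<le> p + c"
      then have "take i w = u @ replicate c m @ take (i - p - c) v" and "i - p - c > 0" and "v \<noteq> []"
        using that by (auto simp: w' p_def)
      with so c have "m \<le> hd v" by (cases v; cases "i - p - c") (auto simp: sorted_append)
      with v \<open>v \<noteq> []\<close> v_le[of "hd v"] show False by auto
    qed
  qed
  have "p + c \<le> length w" by (simp add: w' p_def)
  then have sites_w: "sites w = {i. i \<le> p + c \<and> (i = 0 \<or> (\<forall>b>hd w. count_list (drop i w) b \<le> 1))}"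
    using sorted_take by (auto simp: sites_def)
  show ?thesis
  proof (cases "p = 0")
    case True
    then have "hd w = m" using c by (cases c) (auto simp: w' p_def)
    moreover have "b \<notin> set w" if "b > m" for b
      using that u_le[of b] v_le[of b] by (auto simp: w')
    ultimately have "count_list (drop i w) b \<le> 1" if "b > hd w" for b i
      using that by (metis count_notin in_set_dropD zero_le_one)
    then have "sites w = {..c}" using True by (auto simp: sites_w)
    then show ?thesis using True by (simp add: label)
  next
    case False
    then have "u \<noteq> []" by (simp add: p_def)
    then have hd: "hd w = hd u" "hd s = hd u" and um: "hd u < m"
      using u_le by (auto simp: w' s p_def)
    \<comment> \<open>Because \<open>p\<close> is a site of \<open>s\<close>, letters other than
      \<open>m\<close> impose no condition on positions from \<open>p\<close> on.\<close>
    have v'1: "count_list v' b \<le> 1" if "b > hd u" for b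
      using ps that False by (simp add: sites_def s p_def hd)
    have cv: "count_list v b = count_list v' b" if "b \<noteq> m" for b
      unfolding v'_def using that by (induction v) auto
    \<comment> \<open>Of the \<open>a\<close> copies of \<open>m\<close>, exactly
      \<open>i - p\<close> lie before position \<open>i\<close>, and at most one may remain.\<close>
    have late: "i \<in> sites w \<longleftrightarrow> p + a \<le> Suc i" if "p \<le> i" "i \<le> p + c" for i
    proof -
      have d: "drop i w = replicate (c - (i - p)) m @ v" using that by (simp add: w' p_def)
      have "count_list (drop i w) b \<le> 1 \<longleftrightarrow> b = m \<longrightarrow> p + a \<le> Suc i" if "b > hd u" for b
        using \<open>p \<le> i\<close> \<open>i \<le> p + c\<close> v'1[OF that] cv[of b] by (auto simp: d rep a)
      then show ?thesis using that False um by (auto simp: sites_w hd)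
    qed
    \<comment> \<open>Before \<open>p\<close> all copies of \<open>m\<close> are still to come, so a
      nonzero site requires \<open>a = 1\<close>; the other letters give the condition for
      \<open>s\<close>.\<close>
    have early: "i \<in> sites w \<longleftrightarrow> i = 0 \<or> a = 1 \<and> i \<in> sites s" if "i < p" for i
    proof -
      have d: "drop i w = drop i u @ replicate c m @ v" "drop i s = drop i u @ v'"
        using that by (simp_all add: w' s p_def)
      have "m \<notin> set (drop i u)" using u by (auto dest: in_set_dropD)
      then have dm: "count_list (drop i w) m = a" by (simp add: d rep a)
      have db: "count_list (drop i w) b = count_list (drop i s) b" if "b \<noteq> m" for b
        using that by (simp add: d rep cv)
      have sm: "count_list (drop i s) m = 0"
        using less by (auto simp: count_list_0_iff dest!: in_set_dropD)
      have "sorted (take i s)" using that su by (simp add: s p_def sorted_wrt_take)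
      then have "i \<in> sites s \<longleftrightarrow> i = 0 \<or> (\<forall>b>hd u. count_list (drop i s) b \<le> 1)"
        using that \<open>u \<noteq> []\<close> by (auto simp: sites_def s p_def)
      moreover have "i \<in> sites w \<longleftrightarrow> i = 0 \<or> (\<forall>b>hd u. count_list (drop i w) b \<le> 1)"
        using that by (auto simp: sites_w hd)
      moreover have "a \<le> 1 \<longleftrightarrow> a = 1" using a c by auto
      ultimately show ?thesis using dm db sm um by (metis zero_le_one)
    qed
    have bound: "i \<le> p + c" if "i \<in> sites w" for i using that by (simp add: sites_w)
    have ac: "c \<le> a" by (simp add: a)
    \<comment> \<open>The four cases match the branches of \<open>site_label\<close> with 0 not in
      the multiset.\<close>
    consider "a = 1" "c = 1" | "a \<ge> 2" "c = a" | "a \<ge> 2" "Suc c = a" | "a \<ge> 2" "Suc c < a"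
      using ac c by linarith
    then show ?thesis
    proof cases
      case 1
      have "sites w = insert (Suc p) {x \<in> sites s. x \<le> p}"
      proof (intro set_eqI)
        fix i
        show "i \<in> sites w \<longleftrightarrow> i \<in> insert (Suc p) {x \<in> sites s. x \<le> p}"
          using early[of i] late[of i] bound[of i] 1 ps zero_in_sites[of s]
          by (cases "i < p"; cases "i = p"; cases "i = Suc p") auto
      qed
      then show ?thesis using 1 False finite_sites[of s] by (simp add: label)
    next
      case 2
      have "sites w = {0, p + a - 1, p + a}"
      proof (intro set_eqI)
        fix i
        show "i \<in> sites w \<longleftrightarrow> i \<in> {0, p + a - 1, p + a}"
          using early[of i] late[of i] bound[of i] 2 False by (cases "i < p") auto
      qed
      then show ?thesis using 2 False by (simp add: label)
    next
      case 3
      have "sites w = {0, p + c}"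
      proof (intro set_eqI)
        fix i
        show "i \<in> sites w \<longleftrightarrow> i \<in> {0, p + c}"
          using early[of i] late[of i] bound[of i] 3 False by (cases "i < p") auto
      qed
      then show ?thesis using 3 False by (simp add: label)
    next
      case 4
      have "sites w = {0}"
      proof (intro set_eqI)
        fix i
        show "i \<in> sites w \<longleftrightarrow> i \<in> {0}"
          using early[of i] late[of i] bound[of i] 4 False by (cases "i < p") auto
      qed
      then show ?thesis using 4 False by (simp add: label)
    qed
  qed
qed

section \<open>Counting avoiders\<close>

definition avoiders_213_1322 :: "nat multiset \<Rightarrow> nat list set" where
  "avoiders_213_1322 S = {w \<in> permutations_of_multiset S. avoids_213_1322 w}"

lemma finite_avoiders_213_1322: "finite (avoiders_213_1322 S)"
  by (simp add: avoiders_213_1322_def)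

text \<open>Avoiders are grouped by the word left after deleting \<open>m\<close>. Within a group
  \<open>gaps\<close> is a bijection onto the multisets of sites of that word, and
  \<open>card_sites\<close> turns the statistic into the label.\<close>

lemma sum_avoiders_213_1322_step:
  assumes less: "\<And>x. x \<in># S \<Longrightarrow> x < m" and a: "a \<ge> 1"
  shows "(\<Sum>w\<in>avoiders_213_1322 (S + replicate_mset a m). \<phi> (card (sites w) - 1)) =
    (\<Sum>s\<in>avoiders_213_1322 S. transfer a \<phi> (card (sites s) - 1))"
proof -
  define F where "F s = {w. filter (\<lambda>x. x \<noteq> m) w = s \<and> gaps m w \<in> multisets_over (sites s) a}" for s
  have s_less: "\<forall>x\<in>set s. x < m" and s_m: "m \<notin> set s" if "s \<in> avoiders_213_1322 S" for s
    using that less by (force simp: avoiders_213_1322_def dest!: permutations_of_multisetD)+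
  have bij: "bij_betw (gaps m) (F s) (multisets_over (sites s) a)" if "s \<in> avoiders_213_1322 S" for s
    unfolding F_def using s_m[OF that] by (intro bij_betw_gaps) (auto simp: sites_def)
  have fin: "finite (F s)" if "s \<in> avoiders_213_1322 S" for s
    using bij_betw_finite[OF bij[OF that]] finite_multisets_over[OF finite_sites] by simp
  have disj: "\<forall>s\<in>avoiders_213_1322 S. \<forall>t\<in>avoiders_213_1322 S. s \<noteq> t \<longrightarrow> F s \<inter> F t = {}"
    by (auto simp: F_def)
  have "avoiders_213_1322 (S + replicate_mset a m) = (\<Union>s\<in>avoiders_213_1322 S. F s)"
  proof (intro equalityI subsetI)
    fix w assume w: "w \<in> avoiders_213_1322 (S + replicate_mset a m)"
    then have m_w: "mset w = S + replicate_mset a m" and Q: "avoids_213_1322 w"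
      by (auto simp: avoiders_213_1322_def dest: permutations_of_multisetD)
    define s where "s = filter (\<lambda>x. x \<noteq> m) w"
    have "filter_mset (\<lambda>x. x \<noteq> m) S = S" "m \<notin># S"
      using less by (force simp: filter_mset_eq_conv)+
    then have m_s: "mset s = S" and cnt: "count (mset w) m = a"
      by (simp_all add: s_def m_w not_in_iff)
    then have "\<forall>x\<in>set s. x < m" using less by auto
    from avoids_213_1322_iff_gaps[OF s_def[symmetric] this] Q
    have "avoids_213_1322 s" "gaps m w \<in> multisets_over (sites s) a"
      using cnt by (auto simp: multisets_over_def size_gaps)
    with m_s show "w \<in> (\<Union>s\<in>avoiders_213_1322 S. F s)"
      by (auto simp: avoiders_213_1322_def F_def s_def intro: permutations_of_multisetI)
  next
    fix w assume "w \<in> (\<Union>s\<in>avoiders_213_1322 S. F s)"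
    then obtain s where s: "s \<in> avoiders_213_1322 S" and f: "filter (\<lambda>x. x \<noteq> m) w = s"
      and g: "set_mset (gaps m w) \<subseteq> sites s" "size (gaps m w) = a"
      by (auto simp: F_def multisets_over_def)
    have "mset w = filter_mset (\<lambda>x. x \<noteq> m) (mset w) + filter_mset (\<lambda>x. \<not> x \<noteq> m) (mset w)"
      by (rule multiset_partition)
    also have "\<dots> = mset s + replicate_mset a m"
      using f g by (simp add: filter_eq_replicate_mset size_gaps flip: mset_filter)
    finally have "mset w = S + replicate_mset a m"
      using s by (auto simp: avoiders_213_1322_def dest: permutations_of_multisetD)
    moreover have "avoids_213_1322 w"
      using avoids_213_1322_iff_gaps[OF f s_less[OF s]] s g by (simp add: avoiders_213_1322_def)
    ultimately show "w \<in> avoiders_213_1322 (S + replicate_mset a m)"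
      by (auto simp: avoiders_213_1322_def intro: permutations_of_multisetI)
  qed
  then have "(\<Sum>w\<in>avoiders_213_1322 (S + replicate_mset a m). \<phi> (card (sites w) - 1)) =
    (\<Sum>s\<in>avoiders_213_1322 S. \<Sum>w\<in>F s. \<phi> (card (sites w) - 1))"
    using fin by (simp add: sum.UNION_disjoint finite_avoiders_213_1322 disj)
  also have "\<dots> = (\<Sum>s\<in>avoiders_213_1322 S. transfer a \<phi> (card (sites s) - 1))"
  proof (intro sum.cong refl)
    fix s assume s: "s \<in> avoiders_213_1322 S"
    have "card (sites w) - 1 = site_label (sites s) (gaps m w)" if "w \<in> F s" for w
    proof -
      have "count (mset w) m = a" using that by (simp add: F_def multisets_over_def flip: size_gaps)
      then have "m \<in> set w" using a by (metis count_mset_0_iff not_one_le_zero)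
      with that s_less[OF s] show ?thesis
        by (intro card_sites) (auto simp: F_def multisets_over_def)
    qed
    then have "(\<Sum>w\<in>F s. \<phi> (card (sites w) - 1)) = (\<Sum>w\<in>F s. \<phi> (site_label (sites s) (gaps m w)))"
      by simp
    also have "\<dots> = (\<Sum>M\<in>multisets_over (sites s) a. \<phi> (site_label (sites s) M))"
      by (rule sum.reindex_bij_betw[OF bij[OF s]])
    also have "\<dots> = transfer a \<phi> (card (sites s) - 1)"
      by (rule sum_site_label) (use a in \<open>auto simp: finite_sites zero_in_sites\<close>)
    finally show "(\<Sum>w\<in>F s. \<phi> (card (sites w) - 1)) = transfer a \<phi> (card (sites s) - 1)" .
  qed
  finally show ?thesis .
qed

text \<open>Arbitrary \<open>\<phi>\<close> is what makes the induction work: removing the largest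
  letter replaces \<open>\<phi>\<close> by its transfer. The empty word has one site, whence the
  evaluation at 0.\<close>

lemma sum_avoiders_213_1322:
  assumes "set_mset S = {1..k}"
  shows "(\<Sum>w\<in>avoiders_213_1322 S. \<phi> (card (sites w) - 1)) =
    foldr transfer (map (count S) [1..<Suc k]) \<phi> 0"
  using assms
proof (induction k arbitrary: S \<phi>)
  case 0
  then have "S = {#}" by simp
  then have "avoiders_213_1322 S = {[]}"
    by (auto simp: avoiders_213_1322_def avoids_213_1322_def)
  moreover have "sites [] = {0}" by (auto simp: sites_def)
  ultimately show ?case by simp
next
  case (Suc k)
  define T where "T = filter_mset (\<lambda>x. x \<noteq> Suc k) S"
  have S: "S = T + replicate_mset (count S (Suc k)) (Suc k)"
    unfolding T_def by (auto simp: multiset_eq_iff)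
  have T: "set_mset T = {1..k}" using Suc.prems by (auto simp: T_def)
  have "Suc k \<in># S" using Suc.prems by simp
  then have "count S (Suc k) \<ge> 1" by (simp add: Suc_le_eq)
  from sum_avoiders_213_1322_step[of T "Suc k", OF _ this, of \<phi>] T
  have "(\<Sum>w\<in>avoiders_213_1322 S. \<phi> (card (sites w) - 1)) =
    (\<Sum>s\<in>avoiders_213_1322 T. transfer (count S (Suc k)) \<phi> (card (sites s) - 1))"
    by (simp flip: S)
  also have "\<dots> = foldr transfer (map (count T) [1..<Suc k]) (transfer (count S (Suc k)) \<phi>) 0"
    by (rule Suc.IH[OF T])
  also have "map (count T) [1..<Suc k] = map (count S) [1..<Suc k]"
    by (auto simp: T_def)
  finally show ?case by simp
qed

section \<open>Pattern containment in terms of subsequences\<close>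

lemma subseq_iff_strict_mono:
  "subseq v w \<longleftrightarrow> (\<exists>i. strict_mono_on {..<length v} i \<and> (\<forall>a<length v. i a < length w \<and> w ! i a = v ! a))"
proof
  assume "subseq v w"
  then show "\<exists>i. strict_mono_on {..<length v} i \<and> (\<forall>a<length v. i a < length w \<and> w ! i a = v ! a)"
  proof (induction rule: list_emb.induct)
    case (list_emb_Nil ys)
    then show ?case by (simp add: strict_mono_on_def)
  next
    case (list_emb_Cons xs ys y)
    then obtain i where "strict_mono_on {..<length xs} i" "\<forall>a<length xs. i a < length ys \<and> ys ! i a = xs ! a"
      by blast
    then show ?case by (intro exI[of _ "Suc \<circ> i"]) (auto simp: strict_mono_on_def)
  next
    case (list_emb_Cons2 x y xs ys)
    then obtain i where i: "strict_mono_on {..<length xs} i" "\<forall>a<length xs. i a < length ys \<and> ys ! i a = xs ! a"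
      by blast
    \<comment> \<open>The matched head goes to position 0, and all other positions shift by
      one.\<close>
    define j where "j a = (case a of 0 \<Rightarrow> 0 | Suc a \<Rightarrow> Suc (i a))" for a
    have "strict_mono_on {..<length (x # xs)} j"
      using i(1) by (auto simp: strict_mono_on_def j_def split: nat.splits)
    moreover have "\<forall>a<length (x # xs). j a < length (y # ys) \<and> (y # ys) ! j a = (x # xs) ! a"
      using i(2) list_emb_Cons2.hyps by (auto simp: j_def split: nat.splits)
    ultimately show ?case by blast
  qed
next
  assume "\<exists>i. strict_mono_on {..<length v} i \<and> (\<forall>a<length v. i a < length w \<and> w ! i a = v ! a)"
  then obtain i where i: "strict_mono_on {..<length v} i" "\<And>a. a < length v \<Longrightarrow> i a < length w \<and> w ! i a = v ! a"
    by blast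
  then show "subseq v w"
  proof (induction w arbitrary: v i)
    case Nil
    then show ?case by (cases v) auto
  next
    case (Cons y w)
    show ?case
    proof (cases v)
      case v: (Cons x v')
      have pos: "i a > 0" if "0 < a" "a < length v" for a
        using strict_mono_onD[OF Cons.prems(1), of 0 a] that v by auto
      show ?thesis
      proof (cases "i 0 = 0")
        case True
        have "subseq v' w"
        proof (rule Cons.IH)
          show "strict_mono_on {..<length v'} (\<lambda>a. i (Suc a) - 1)"
          proof (rule strict_mono_onI)
            fix a b assume "a \<in> {..<length v'}" "b \<in> {..<length v'}" "a < b"
            then show "i (Suc a) - 1 < i (Suc b) - 1"
              using strict_mono_onD[OF Cons.prems(1), of "Suc a" "Suc b"] pos[of "Suc a"] v by simp
          qed
          show "i (Suc a) - 1 < length w \<and> w ! (i (Suc a) - 1) = v' ! a" if "a < length v'" for a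
            using Cons.prems(2)[of "Suc a"] pos[of "Suc a"] that v by (cases "i (Suc a)") auto
        qed
        moreover have "x = y" using Cons.prems(2)[of 0] True v by simp
        ultimately show ?thesis using v by simp
      next
        case False
        then have pos: "i a > 0" if "a < length v" for a
          using pos[of a] that by (cases "a = 0") auto
        have "subseq v w"
        proof (rule Cons.IH)
          show "strict_mono_on {..<length v} (\<lambda>a. i a - 1)"
          proof (rule strict_mono_onI)
            fix a b assume "a \<in> {..<length v}" "b \<in> {..<length v}" "a < b"
            then show "i a - 1 < i b - 1"
              using strict_mono_onD[OF Cons.prems(1), of a b] pos[of a] by simp
          qed
          show "i a - 1 < length w \<and> w ! (i a - 1) = v ! a" if "a < length v" for a
            using Cons.prems(2)[of a] pos[of a] that by (cases "i a") auto
        qed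
        then show ?thesis by auto
      qed
    qed simp
  qed
qed

text \<open>The condition on \<open>>\<close> in \<open>contains_pattern\<close> is the one on
  \<open><\<close> with the indices exchanged.\<close>

lemma contains_pattern_iff_subseq:
  "contains_pattern w r \<longleftrightarrow> (\<exists>v. subseq v w \<and> length v = length r \<and>
     (\<forall>a<length r. \<forall>b<length r. v ! a < v ! b \<longleftrightarrow> r ! a < r ! b))"
proof
  assume "contains_pattern w r"
  then obtain i where i: "strict_mono_on {..<length r} i" "\<forall>a<length r. i a < length w"
    "\<forall>a<length r. \<forall>b<length r. w ! i a < w ! i b \<longleftrightarrow> r ! a < r ! b"
    unfolding contains_pattern_def by blast
  then show "\<exists>v. subseq v w \<and> length v = length r \<and>
     (\<forall>a<length r. \<forall>b<length r. v ! a < v ! b \<longleftrightarrow> r ! a < r ! b)"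
    by (intro exI[of _ "map (\<lambda>a. w ! i a) [0..<length r]"])
      (auto simp: subseq_iff_strict_mono)
next
  assume "\<exists>v. subseq v w \<and> length v = length r \<and>
     (\<forall>a<length r. \<forall>b<length r. v ! a < v ! b \<longleftrightarrow> r ! a < r ! b)"
  then obtain v i where "length v = length r" "\<forall>a<length r. \<forall>b<length r. v ! a < v ! b \<longleftrightarrow> r ! a < r ! b"
    "strict_mono_on {..<length v} i" "\<forall>a<length v. i a < length w \<and> w ! i a = v ! a"
    unfolding subseq_iff_strict_mono by blast
  then show "contains_pattern w r"
    unfolding contains_pattern_def by (intro exI[of _ i]) auto
qed

lemma all_less_3: "(\<forall>i<3::nat. P i) \<longleftrightarrow> P 0 \<and> P 1 \<and> P 2"
  by (auto simp: numeral_3_eq_3 numeral_2_eq_2 less_Suc_eq)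

lemma all_less_4: "(\<forall>i<4::nat. P i) \<longleftrightarrow> P 0 \<and> P 1 \<and> P 2 \<and> P 3"
  by (auto simp: numeral_eq_Suc less_Suc_eq)

lemma ex_length_3: "(\<exists>v. length v = 3 \<and> P v) \<longleftrightarrow> (\<exists>x y z. P [x, y, z])"
  by (auto simp: numeral_eq_Suc length_Suc_conv; blast)

lemma ex_length_4: "(\<exists>v. length v = 4 \<and> P v) \<longleftrightarrow> (\<exists>x y z t. P [x, y, z, t])"
  by (auto simp: numeral_eq_Suc length_Suc_conv; blast)

lemma contains_pattern_3:
  "contains_pattern w [p, q, r] \<longleftrightarrow> (\<exists>x y z. subseq [x, y, z] w \<and>
     (\<forall>a<3. \<forall>b<3. [x, y, z] ! a < [x, y, z] ! b \<longleftrightarrow> [p, q, r] ! a < [p, q, r] ! b))"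
  unfolding contains_pattern_iff_subseq
  using ex_length_3[of "\<lambda>v. subseq v w \<and> (\<forall>a<3. \<forall>b<3. v ! a < v ! b \<longleftrightarrow> [p, q, r] ! a < [p, q, r] ! b)"]
  by (auto simp: conj_ac)

lemma contains_pattern_4:
  "contains_pattern w [p, q, r, s] \<longleftrightarrow> (\<exists>x y z t. subseq [x, y, z, t] w \<and>
     (\<forall>a<4. \<forall>b<4. [x, y, z, t] ! a < [x, y, z, t] ! b \<longleftrightarrow> [p, q, r, s] ! a < [p, q, r, s] ! b))"
  unfolding contains_pattern_iff_subseq
  using ex_length_4[of "\<lambda>v. subseq v w \<and> (\<forall>a<4. \<forall>b<4. v ! a < v ! b \<longleftrightarrow> [p, q, r, s] ! a < [p, q, r, s] ! b)"]
  by (auto simp: conj_ac)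

lemma contains_213: "contains_pattern w [2, 1, 3] \<longleftrightarrow> (\<exists>a b c. a < b \<and> b < c \<and> subseq [b, a, c] w)"
  unfolding contains_pattern_3 all_less_3 by (simp; blast dest: less_trans)

lemma contains_132: "contains_pattern w [1, 3, 2] \<longleftrightarrow> (\<exists>a b c. a < b \<and> b < c \<and> subseq [a, c, b] w)"
  unfolding contains_pattern_3 all_less_3 by (simp; blast dest: less_trans)

lemma contains_1322: "contains_pattern w [1, 3, 2, 2] \<longleftrightarrow> (\<exists>a b c. a < b \<and> b < c \<and> subseq [a, c, b, b] w)"
proof
  assume "contains_pattern w [1, 3, 2, 2]"
  then obtain x y z t where "subseq [x, y, z, t] w" "x < z" "z < y" "\<not> z < t" "\<not> t < z"
    unfolding contains_pattern_4 all_less_4 by auto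
  moreover from this have "z = t" by simp
  ultimately show "\<exists>a b c. a < b \<and> b < c \<and> subseq [a, c, b, b] w" by blast
next
  assume "\<exists>a b c. a < b \<and> b < c \<and> subseq [a, c, b, b] w"
  then obtain a b c where "a < b \<and> b < c \<and> subseq [a, c, b, b] w" by blast
  then show "contains_pattern w [1, 3, 2, 2]"
    unfolding contains_pattern_4 all_less_4
    by (intro exI[of _ a] exI[of _ c] exI[of _ b]) simp
qed

lemma contains_2213: "contains_pattern w [2, 2, 1, 3] \<longleftrightarrow> (\<exists>a b c. a < b \<and> b < c \<and> subseq [b, b, a, c] w)"
proof
  assume "contains_pattern w [2, 2, 1, 3]"
  then obtain x y z t where "subseq [x, y, z, t] w" "z < x" "x < t" "\<not> x < y" "\<not> y < x"
    unfolding contains_pattern_4 all_less_4 by auto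
  moreover from this have "x = y" by simp
  ultimately show "\<exists>a b c. a < b \<and> b < c \<and> subseq [b, b, a, c] w" by blast
next
  assume "\<exists>a b c. a < b \<and> b < c \<and> subseq [b, b, a, c] w"
  then obtain a b c where "a < b \<and> b < c \<and> subseq [b, b, a, c] w" by blast
  then show "contains_pattern w [2, 2, 1, 3]"
    unfolding contains_pattern_4 all_less_4
    by (intro exI[of _ b] exI[of _ a] exI[of _ c]) simp
qed

lemma av_213_1322: "av S {[2,1,3], [1,3,2,2]} = card (avoiders_213_1322 S)"
proof -
  have "(\<forall>r\<in>{[2,1,3], [1,3,2,2]}. avoids w r) \<longleftrightarrow> avoids_213_1322 w" for w
    by (auto simp: avoids_def contains_213 contains_1322 avoids_213_1322_def simp del: One_nat_def)
  then show ?thesis by (simp add: av_def avoiders_213_1322_def)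
qed

lemma av_213_1322_eq_foldr:
  assumes "set_mset S = {1..k}"
  shows "av S {[2,1,3], [1,3,2,2]} = foldr transfer (map (count S) [1..<Suc k]) (\<lambda>_. 1) 0"
  using sum_avoiders_213_1322[OF assms, of "\<lambda>_. 1"] by (simp add: av_213_1322 del: One_nat_def upt_Suc)

section \<open>Reverse-complementation\<close>

lemma subseq_rev: "subseq v w \<Longrightarrow> subseq (rev v) (rev w)"
  by (induction rule: list_emb.induct) (auto intro: list_emb_append_mono)

text \<open>An order-reversing involution on \<open>{1..k}\<close>. Above \<open>Suc k\<close> the
  subtraction truncates, hence the range assumptions on words below.\<close>

definition complement :: "nat \<Rightarrow> nat \<Rightarrow> nat" where
  "complement k x = Suc k - x"

text \<open>Reversing and complementing takes 213 to 132 and 1322 to 2213. The map is an involution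
  on words over \<open>{1..k}\<close>, so occurrences can be carried in both directions.\<close>

lemma reverse_complement_avoids:
  assumes "set w \<subseteq> {1..k}"
  shows "avoids w [1,3,2] \<and> avoids w [2,2,1,3] \<longleftrightarrow> avoids_213_1322 (rev (map (complement k) w))"
    (is "_ \<longleftrightarrow> avoids_213_1322 (?rc w)")
proof -
  have rc: "subseq (rev (map (complement k) v)) (?rc u)" if "subseq v u" for v u
    using subseq_map[OF that] by (rule subseq_rev)
  have "complement k ` {1..k} \<subseteq> {1..k}" by (auto simp: complement_def)
  then have set_rc: "set (?rc w) \<subseteq> {1..k}" using image_mono[OF assms, of "complement k"] by auto
  have "map (complement k \<circ> complement k) w = map id w"
    using assms by (intro map_cong refl) (auto simp: complement_def)
  then have rc_rc: "?rc (?rc w) = w" by (simp add: rev_map)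
  have less: "complement k y < complement k x" if "x < y" "y \<le> k" for x y
    using that by (auto simp: complement_def)
  show ?thesis
  proof
    assume L: "avoids w [1,3,2] \<and> avoids w [2,2,1,3]"
    show "avoids_213_1322 (?rc w)"
      unfolding avoids_213_1322_def
    proof (intro allI impI conjI notI)
      fix a b c assume abc: "a < b \<and> b < c" and sub: "subseq [b, a, c] (?rc w)"
      have "c \<le> k" using subseq_imp_subset[OF sub] set_rc by auto
      then have "complement k c < complement k b" "complement k b < complement k a"
        using abc less by auto
      moreover have "subseq [complement k c, complement k a, complement k b] w"
        using rc[OF sub] rc_rc by simp
      ultimately show False using L unfolding avoids_def contains_132 by blast
    next
      fix a b c assume abc: "a < b \<and> b < c" and sub: "subseq [a, c, b, b] (?rc w)"
      have "c \<le> k" using subseq_imp_subset[OF sub] set_rc by auto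
      then have "complement k c < complement k b" "complement k b < complement k a"
        using abc less by auto
      moreover have "subseq [complement k b, complement k b, complement k c, complement k a] w"
        using rc[OF sub] rc_rc by simp
      ultimately show False using L unfolding avoids_def contains_2213 by blast
    qed
  next
    assume R: "avoids_213_1322 (?rc w)"
    show "avoids w [1,3,2] \<and> avoids w [2,2,1,3]"
      unfolding avoids_def contains_132 contains_2213
    proof (intro conjI notI; elim exE conjE)
      fix a b c assume abc: "a < b" "b < c" and sub: "subseq [a, c, b] w"
      have "c \<le> k" using subseq_imp_subset[OF sub] assms by auto
      then have "complement k c < complement k b" "complement k b < complement k a"
        using abc less by auto
      then show False using R rc[OF sub] unfolding avoids_213_1322_def by auto
    next
      fix a b c assume abc: "a < b" "b < c" and sub: "subseq [b, b, a, c] w"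
      have "c \<le> k" using subseq_imp_subset[OF sub] assms by auto
      then have "complement k c < complement k b" "complement k b < complement k a"
        using abc less by auto
      then show False using R rc[OF sub] unfolding avoids_213_1322_def by auto
    qed
  qed
qed

lemma av_reverse_complement:
  assumes S: "set_mset S = {1..k}"
  shows "av S {[1,3,2], [2,2,1,3]} = av (image_mset (complement k) S) {[2,1,3], [1,3,2,2]}"
proof -
  let ?c = "complement k"
  have set_w: "set w \<subseteq> {1..k}" if "mset w = S" for w
    using arg_cong[OF that, of set_mset] S by simp
  have cc: "?c (?c x) = x" if "x \<in> {1..k}" for x using that by (auto simp: complement_def)
  have inv: "rev (map ?c (rev (map ?c w))) = w" if "set w \<subseteq> {1..k}" for w
  proof -
    have "map (?c \<circ> ?c) w = map id w" using that cc by (intro map_cong refl) auto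
    then show ?thesis by (simp add: rev_map)
  qed
  have "image_mset (?c \<circ> ?c) S = image_mset id S" using S cc by (intro image_mset_cong) auto
  then have inv_S: "image_mset ?c (image_mset ?c S) = S" by (simp add: image_mset.compositionality)
  have left: "{w \<in> permutations_of_multiset S. \<forall>r\<in>{[1,3,2], [2,2,1,3]}. avoids w r} =
      {w. mset w = S \<and> avoids_213_1322 (rev (map ?c w))}" (is "?A = ?L")
  proof (intro Collect_cong)
    fix w
    show "w \<in> permutations_of_multiset S \<and> (\<forall>r\<in>{[1,3,2], [2,2,1,3]}. avoids w r) \<longleftrightarrow>
        mset w = S \<and> avoids_213_1322 (rev (map ?c w))"
      using reverse_complement_avoids[of w k] set_w[of w]
      by (simp add: permutations_of_multiset_def del: One_nat_def cong: conj_cong)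
  qed
  have right: "avoiders_213_1322 (image_mset ?c S) = {w. mset w = image_mset ?c S \<and> avoids_213_1322 w}"
    (is "_ = ?R")
    by (auto simp: avoiders_213_1322_def permutations_of_multiset_def)
  have set_w': "set w \<subseteq> {1..k}" if "mset w = image_mset ?c S" for w
  proof -
    have "set w = ?c ` {1..k}" using arg_cong[OF that, of set_mset] S by simp
    then show ?thesis by (auto simp: complement_def)
  qed
  \<comment> \<open>Reverse-complementation is its own inverse and also exchanges the two multisets
    of letters.\<close>
  have "bij_betw (\<lambda>w. rev (map ?c w)) ?L ?R"
  proof (rule bij_betw_byWitness[where f' = "\<lambda>w. rev (map ?c w)"])
    show "\<forall>w\<in>?L. rev (map ?c (rev (map ?c w))) = w"
      by (intro ballI inv set_w) simp
    show "\<forall>w\<in>?R. rev (map ?c (rev (map ?c w))) = w"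
      by (intro ballI inv set_w') simp
    show "(\<lambda>w. rev (map ?c w)) ` ?L \<subseteq> ?R"
      by auto
    show "(\<lambda>w. rev (map ?c w)) ` ?R \<subseteq> ?L"
    proof (intro image_subsetI)
      fix w assume w: "w \<in> ?R"
      then have "mset (rev (map ?c w)) = S" using inv_S by simp
      moreover have "avoids_213_1322 (rev (map ?c (rev (map ?c w))))"
        using w inv[OF set_w'[of w]] by simp
      ultimately show "rev (map ?c w) \<in> ?L" by simp
    qed
  qed
  then have "card ?A = card ?R" unfolding left by (rule bij_betw_same_card)
  then show ?thesis unfolding av_213_1322 right by (simp only: av_def)
qed

theorem theorem2p20:
  shows "m_equivalent {[1,3,2], [2,2,1,3]} {[2,1,3], [1,3,2,2]}"
  unfolding m_equivalent_def
proof (intro allI impI)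
  fix S assume "reduced_multiset S"
  then obtain k where S: "set_mset S = {1..k}" unfolding reduced_multiset_def by blast
  let ?S' = "image_mset (complement k) S"
  have "complement k ` {1..k} = {1..k}"
  proof (intro equalityI subsetI)
    fix x assume "x \<in> {1..k}"
    then show "x \<in> complement k ` {1..k}"
      by (intro image_eqI[of _ _ "Suc k - x"]) (auto simp: complement_def)
  qed (auto simp: complement_def)
  then have S': "set_mset ?S' = {1..k}" using S by simp
  have count: "count ?S' i = count S (Suc k - i)" if "i \<in> {1..k}" for i
  proof -
    have "complement k -` {i} \<inter> set_mset S = {Suc k - i}"
      unfolding S using that by (auto simp: complement_def)
    then show ?thesis by (simp add: count_image_mset)
  qed
  \<comment> \<open>The list index \<open>i\<close> stands for the letter \<open>i + 1\<close>,
    whose complement is \<open>Suc k - Suc i\<close>.\<close>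
  have rev: "map (count ?S') [1..<Suc k] = rev (map (count S) [1..<Suc k])"
  proof (rule nth_equalityI)
    fix i assume "i < length (map (count ?S') [1..<Suc k])"
    then have "i < k" by (simp del: upt_Suc)
    then have "map (count ?S') [1..<Suc k] ! i = count S (Suc k - Suc i)"
      by (simp add: count del: upt_Suc)
    also from \<open>i < k\<close> have "\<dots> = rev (map (count S) [1..<Suc k]) ! i"
      by (simp add: rev_nth Suc_diff_Suc del: upt_Suc)
    finally show "map (count ?S') [1..<Suc k] ! i = rev (map (count S) [1..<Suc k]) ! i" .
  qed simp
  have "av S {[1,3,2], [2,2,1,3]} = foldr transfer (rev (map (count S) [1..<Suc k])) (\<lambda>_. 1) 0"
    using av_reverse_complement[OF S] av_213_1322_eq_foldr[OF S'] by (simp only: rev)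
  also have "\<dots> = foldr transfer (map (count S) [1..<Suc k]) (\<lambda>_. 1) 0"
  \<comment> \<open>Every letter of \<open>{1..k}\<close> occurs in \<open>S\<close>, which gives
    the positive multiplicities that self-adjointness asks for.\<close>
  proof (rule foldr_transfer_rev[symmetric])
    fix a assume "a \<in> set (map (count S) [1..<Suc k])"
    then obtain x where "x \<in> {1..k}" "a = count S x"
      by (auto simp only: set_map set_upt atLeastLessThanSuc_atLeastAtMost)
    then have "x \<in># S" "a = count S x" using S by auto
    then show "a \<ge> 1" by (simp add: Suc_le_eq)
  qed
  also have "\<dots> = av S {[2,1,3], [1,3,2,2]}"
    by (rule av_213_1322_eq_foldr[OF S, symmetric])
  finally show "av S {[1,3,2], [2,2,1,3]} = av S {[2,1,3], [1,3,2,2]}" .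
qed

end
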